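(* Let $n\ge2$ be an integer. There exist constants $c_1,c_2>0$ depending only on $n$ such that for every integer $H\ge1$, $$c_1H^{n-1/2}\le (2H+1)^n-A_n(1,H)=\sum_{k=2}^nA_n(k,H)\le c_2H^{n-1/2}.$$
   Context: The height of a polynomial is the maximum of the absolute values of its coefficients; it is denoted $H(f)$. If $f\in\mathbb{C}[X]$ has degree $n\ge1$ and its roots, listed with multiplicities, are labelled so that $|\alpha_1|\ge|\alpha_2|\ge\cdots\ge|\alpha_n|$, then $f$ is said to have exactly $k$ roots with maximal modulus if $|\alpha_1|=\cdots=|\alpha_k|$ and either $k=n$ or $|\alpha_k|>|\alpha_{k+1}|$. For positive integers $n,k,H$ with $k\le n$, $A_n(k,H)$ denotes the number of monic polynomials $f(X)=X^n+a_1X^{n-1}+\cdots+a_n\in\mathbb{Z}[X]$ with $H(f)\le H$ having exactly $k$ roots with maximal modulus. *)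

theory Defs
  imports "HOL-Computational_Algebra.Computational_Algebra"
begin

definition height :: "complex poly \<Rightarrow> real" where
  "height f = Max ((\<lambda>i. cmod (coeff f i)) ` {..degree f})"

text \<open>The list \<open>\<alpha>s\<close> is indexed from 0, so \<open>\<alpha>s ! (i - 1)\<close> is the root \<open>\<alpha>\<^sub>i\<close>. Since only moduli are
  compared, the choice of the ordering among roots of equal modulus is irrelevant.\<close>

definition has_exactly_max_modulus_roots :: "complex poly \<Rightarrow> nat \<Rightarrow> bool" where
  "has_exactly_max_modulus_roots f k \<longleftrightarrow>
     1 \<le> k \<and> k \<le> degree f \<and>
     (\<exists>\<alpha>s. mset \<alpha>s = proots f \<and>
           sorted_wrt (\<lambda>x y. cmod x \<ge> cmod y) \<alpha>s \<and>
           (\<forall>i<k. cmod (\<alpha>s ! i) = cmod (\<alpha>s ! 0)) \<and>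
           (k = degree f \<or> cmod (\<alpha>s ! (k - 1)) > cmod (\<alpha>s ! k)))"

definition monic_polys :: "nat \<Rightarrow> nat \<Rightarrow> nat \<Rightarrow> int poly set" where
  "monic_polys n k H =
     {f. degree f = n \<and> lead_coeff f = 1 \<and>
         height (map_poly of_int f) \<le> real H \<and>
         has_exactly_max_modulus_roots (map_poly of_int f) k}"

definition A_num :: "nat \<Rightarrow> nat \<Rightarrow> nat \<Rightarrow> nat" where
  "A_num n k H = card (monic_polys n k H)"

text \<open>The cardinality above is not the default value of \<open>card\<close> for infinite sets.\<close>

lemma finite_monic_polys: "finite (monic_polys n k H)"
proof (rule finite_imageD)
  show "inj_on coeffs (monic_polys n k H)"
    by (intro inj_onI) (simp only: coeffs_eq_iff)
  show "finite (coeffs ` monic_polys n k H)"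
  proof (rule finite_subset)
    show "finite {xs. set xs \<subseteq> {- int H..int H} \<and> length xs \<le> Suc n}"
      by (intro finite_lists_length_le) simp
    show "coeffs ` monic_polys n k H \<subseteq> {xs. set xs \<subseteq> {- int H..int H} \<and> length xs \<le> Suc n}"
    proof (intro image_subsetI CollectI conjI)
      fix f assume "f \<in> monic_polys n k H"
      then have deg: "degree f = n" and h: "height (map_poly of_int f) \<le> real H"
        unfolding monic_polys_def by blast+
      have "degree (map_poly of_int f :: complex poly) = n"
        using deg by (simp add: degree_map_poly)
      then have "coeff f i \<in> {- int H..int H}" if "i \<le> n" for i
      proof -
        have "cmod (coeff (map_poly of_int f) i) \<le> height (map_poly of_int f)"
          unfolding height_def using that \<open>degree (map_poly of_int f :: complex poly) = n\<close>
          by (intro Max_ge finite_imageI imageI) simp_all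
        with h have "\<bar>real_of_int (coeff f i)\<bar> \<le> real H"
          by (simp add: coeff_map_poly)
        then have "\<bar>coeff f i\<bar> \<le> int H" by linarith
        then show ?thesis by (simp add: abs_le_iff)
      qed
      then show "set (coeffs f) \<subseteq> {- int H..int H}"
        unfolding coeffs_def using deg by (auto simp del: upt_Suc)
      show "length (coeffs f) \<le> Suc n"
        using deg by (simp add: coeffs_def)
    qed
  qed
qed

end

theory Submission
  imports Defs
begin

text \<open>
  Write \<open>f = X\<^sup>n + a\<^sub>1 X\<^bsup>n-1\<^esup> + \<dots> + a\<^sub>n\<close> with coefficients bounded by \<open>H\<close>, and let \<open>R\<close> be the largest
  modulus of a root.  If at least two roots (with multiplicity) have modulus \<open>R\<close>, then taking
  a divided difference of \<open>f(x) / x\<^bsup>n-1\<^esup>\<close> at these two roots eliminates \<open>a\<^sub>1\<close> and gives \<open>R\<^sup>2 \<le> n\<^sup>2 H\<close>, so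
  \<open>\<bar>a\<^sub>1\<bar> \<le> n R\<close> is \<open>O(H\<^bsup>1/2\<^esup>)\<close>; this leaves \<open>O(H\<^bsup>n-1/2\<^esup>)\<close> polynomials.  Conversely, if \<open>a\<^sub>1\<^sup>2 \<le> H/2 \<le> a\<^sub>2\<close>,
  then \<open>x\<^sup>2 + a\<^sub>1 x + a\<^sub>2 \<ge> H/4\<close> for all real \<open>x\<close>, which forces all real roots into \<open>[-5, 5]\<close>, whereas
  the size of \<open>a\<^sub>2\<close> forces some root to be larger once \<open>H\<close> is large.  Hence a root of maximal modulus
  is not real, and its complex conjugate is a second one.
\<close>

section \<open>Coefficient bounds from root moduli\<close>

text \<open>Up to sign, the coefficient is an elementary symmetric function of the list. Multiplying
  by one more linear factor adds two neighbouring bounds, and Pascal's rule merges their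
  binomials.\<close>

lemma norm_coeff_prod_linear_factors:
  fixes xs :: "'a :: real_normed_field list"
  assumes "\<And>x. x \<in> set xs \<Longrightarrow> norm x \<le> R" "R \<ge> 0"
  shows "norm (coeff (\<Prod>x\<leftarrow>xs. [:-x, 1:]) i) \<le> real (length xs choose i) * R ^ (length xs - i)"
  using assms(1)
proof (induction xs arbitrary: i)
  case Nil
  show ?case by (cases i) auto
next
  case (Cons x xs)
  define p where "p = (\<Prod>x\<leftarrow>xs. [:-x, 1:])"
  have IH: "norm (coeff p i) \<le> real (length xs choose i) * R ^ (length xs - i)" for i
    unfolding p_def using Cons by simp
  have IH': "norm (x * coeff p i) \<le> R * (real (length xs choose i) * R ^ (length xs - i))" for i
    unfolding norm_mult using Cons.prems[of x] IH[of i] assms(2) by (intro mult_mono) auto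
  show ?case
  proof (cases i)
    case 0
    then show ?thesis using IH'[of 0]
      by (simp flip: p_def add: norm_mult)
  next
    case (Suc j)
    have "norm (coeff (\<Prod>x\<leftarrow>x # xs. [:-x, 1:]) i) \<le> norm (x * coeff p i) + norm (coeff p j)"
      using norm_triangle_ineq4[of "coeff p j" "x * coeff p i"]
      by (simp flip: p_def add: Suc add.commute)
    also have "\<dots> \<le> R * (real (length xs choose i) * R ^ (length xs - i))
        + real (length xs choose j) * R ^ (length xs - j)"
      using IH'[of i] IH[of j] by simp
    \<comment> \<open>For \<open>i > length xs\<close> the truncated subtraction spoils the
      exponents, but there the binomial coefficient is zero.\<close>
    also have "R * (real (length xs choose i) * R ^ (length xs - i)) =
        real (length xs choose i) * R ^ (length xs - j)"
    proof (cases "i \<le> length xs")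
      case True
      then have "length xs - j = Suc (length xs - i)" using Suc by simp
      then show ?thesis by simp
    qed (simp add: binomial_eq_0)
    finally show ?thesis by (simp add: Suc algebra_simps)
  qed
qed

lemma norm_coeff_le_of_roots:
  fixes p :: "complex poly"
  assumes "lead_coeff p = 1" "\<And>x. poly p x = 0 \<Longrightarrow> cmod x \<le> R" "R \<ge> 0"
  shows "cmod (coeff p i) \<le> real (degree p choose i) * R ^ (degree p - i)"
proof -
  obtain xs where xs: "mset xs = proots p" using ex_mset by blast
  have p: "p = (\<Prod>x\<leftarrow>xs. [:-x, 1:])"
    using complex_poly_decompose_multiset[of p] assms(1)
    by (simp flip: xs prod_mset_prod_list)
  have len: "length xs = degree p"
    using size_proots_complex[of p] by (simp flip: xs)
  have "cmod x \<le> R" if "x \<in> set xs" for x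
  proof -
    have "x \<in># proots p" using that by (simp flip: xs)
    moreover have "p \<noteq> 0" using assms(1) by auto
    ultimately show ?thesis using assms(2) by simp
  qed
  then show ?thesis
    using norm_coeff_prod_linear_factors[of xs R i] assms(3) by (simp flip: p len)
qed

section \<open>Modulus bound for two roots of equal modulus\<close>

lemma poly_monic_split:
  fixes p :: "'a :: comm_ring_1 poly"
  assumes "degree p = n" "lead_coeff p = 1" "n \<ge> 1"
  shows "poly p x = x ^ n + coeff p (n - 1) * x ^ (n - 1) + (\<Sum>i<n-1. coeff p i * x ^ i)"
proof -
  obtain m where m: "n = Suc m" using assms(3) by (cases n) auto
  show ?thesis
    using assms(1,2) by (simp add: poly_altdef m lessThan_Suc flip: lessThan_Suc_atMost)
qed

text \<open>For distinct roots \<open>a\<close>, \<open>b\<close>, dividing \<open>p(a) = 0\<close> by \<open>a\<^bsup>n-1\<^esup>\<close> and subtracting the same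
  relation for \<open>b\<close> eliminates the coefficient of \<open>x\<^bsup>n-1\<^esup>\<close>.  For a double root the same is achieved
  by the combination \<open>a p'(a) - (n-1) p(a)\<close>.\<close>

lemma two_distinct_roots_modulus_bound:
  fixes p :: "complex poly"
  assumes deg: "degree p = n" "lead_coeff p = 1" "n \<ge> 1"
    and H: "\<And>i. i < n - 1 \<Longrightarrow> cmod (coeff p i) \<le> H" "H \<ge> 0"
    and roots: "poly p a = 0" "poly p b = 0" "a \<noteq> b"
    and R: "cmod a = R" "cmod b = R" "R \<ge> 1"
  shows "R ^ 2 \<le> real n ^ 2 * H"
proof -
  have *: "x + coeff p (n - 1) + (\<Sum>i<n-1. coeff p i * inverse x ^ (n - 1 - i)) = 0"
    if "poly p x = 0" "x \<noteq> 0" for x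
  proof -
    have xn: "x ^ n = x ^ (n - 1) * x" using deg(3) by (cases n) auto
    have "x ^ i = x ^ (n - 1) * inverse x ^ (n - 1 - i)" if "i < n - 1" for i
    proof -
      have "x ^ (n - 1) = x ^ i * x ^ (n - 1 - i)"
        using that by (simp flip: power_add)
      then show ?thesis using \<open>x \<noteq> 0\<close> by (simp add: field_simps)
    qed
    then have "(\<Sum>i<n-1. coeff p i * x ^ i) =
        (\<Sum>i<n-1. x ^ (n - 1) * (coeff p i * inverse x ^ (n - 1 - i)))"
      by (intro sum.cong) (auto simp: mult_ac)
    then have "x ^ (n - 1) * (x + coeff p (n - 1) + (\<Sum>i<n-1. coeff p i * inverse x ^ (n - 1 - i))) =
        poly p x"
      unfolding poly_monic_split[OF deg] xn by (simp add: algebra_simps sum_distrib_left)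
    then show ?thesis using that by simp
  qed
  have nz: "a \<noteq> 0" "b \<noteq> 0" using R by auto
  define u v where "u = inverse a" and "v = inverse b"
  have uv: "cmod u \<le> 1" "cmod v \<le> 1"
    using R by (simp_all add: u_def v_def norm_inverse inverse_le_1_iff)
  \<comment> \<open>Both sides of the final estimate thus carry the factor
    \<open>cmod (v - u)\<close>, which is nonzero since \<open>a \<noteq> b\<close> and can be
    cancelled, leaving \<open>R ^ 2\<close>.\<close>
  have duv: "cmod (v - u) * R ^ 2 = cmod (a - b)"
  proof -
    have "(v - u) * (a * b) = a - b" using nz by (simp add: u_def v_def field_simps)
    then have "cmod (v - u) * (cmod a * cmod b) = cmod (a - b)" by (metis norm_mult)
    then show ?thesis using R by (simp add: power2_eq_square)
  qed
  have "a - b = (\<Sum>i<n-1. coeff p i * v ^ (n - 1 - i)) - (\<Sum>i<n-1. coeff p i * u ^ (n - 1 - i))"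
  proof -
    have "x - y = t - s" if "x + c + s = 0" "y + c + t = 0" for x y c s t :: complex
      using that by algebra
    from this[OF *[OF roots(1) nz(1)] *[OF roots(2) nz(2)]] show ?thesis by (simp only: u_def v_def)
  qed
  also have "\<dots> = (\<Sum>i<n-1. coeff p i * (v ^ (n - 1 - i) - u ^ (n - 1 - i)))"
    by (simp add: sum_subtractf algebra_simps)
  finally have "cmod (a - b) \<le> (\<Sum>i<n-1. cmod (coeff p i * (v ^ (n - 1 - i) - u ^ (n - 1 - i))))"
    by (simp add: norm_sum)
  also have "\<dots> \<le> (\<Sum>i<n-1. H * (real n * cmod (v - u)))"
  proof (intro sum_mono)
    fix i assume "i \<in> {..<n-1}"
    then have i: "i < n - 1" by simp
    \<comment> \<open>Since \<open>R \<ge> 1\<close>, the inverses lie in the closed unit disc,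
      where the power map of exponent k is Lipschitz with constant k.\<close>
    have "cmod (v ^ (n - 1 - i) - u ^ (n - 1 - i)) \<le> real (n - 1 - i) * cmod (v - u)"
      using uv by (intro norm_power_diff) auto
    also have "\<dots> \<le> real n * cmod (v - u)" by (intro mult_right_mono) auto
    finally show "cmod (coeff p i * (v ^ (n - 1 - i) - u ^ (n - 1 - i))) \<le> H * (real n * cmod (v - u))"
      unfolding norm_mult using H i by (intro mult_mono) auto
  qed
  also have "\<dots> = real (n - 1) * (real n * H * cmod (v - u))" by simp
  also have "\<dots> \<le> real n * (real n * H * cmod (v - u))"
    using H(2) by (intro mult_right_mono) auto
  finally have "cmod (v - u) * R ^ 2 \<le> cmod (v - u) * (real n ^ 2 * H)"
    unfolding duv by (simp add: power2_eq_square mult_ac)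
  moreover have "cmod (v - u) > 0" using roots(3) by (auto simp: u_def v_def)
  ultimately show ?thesis by simp
qed

text \<open>The Euler operator x d/dx keeps every exponent, so the result can be combined with
  \<open>p\<close> term by term.\<close>

lemma mult_poly_pderiv:
  "x * poly (pderiv p) x = (\<Sum>i\<le>degree p. of_nat i * coeff p i * x ^ i)"
  for p :: "'a :: {idom, semiring_char_0} poly"
proof (cases "degree p")
  case 0
  then show ?thesis by (auto elim!: degree_eq_zeroE simp: pderiv_pCons)
next
  case (Suc m)
  have "x * poly (pderiv p) x = (\<Sum>i\<le>m. of_nat (Suc i) * coeff p (Suc i) * x ^ Suc i)"
    by (simp add: poly_altdef degree_pderiv Suc coeff_pderiv sum_distrib_left mult_ac)
  also have "\<dots> = (\<Sum>i\<le>Suc m. of_nat i * coeff p i * x ^ i)"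
    by (subst sum.atMost_Suc_shift) simp
  finally show ?thesis by (simp add: Suc)
qed

lemma double_root_modulus_bound:
  fixes p :: "complex poly"
  assumes deg: "degree p = n" "lead_coeff p = 1" "n \<ge> 2"
    and H: "\<And>i. i < n - 1 \<Longrightarrow> cmod (coeff p i) \<le> H" "H \<ge> 0"
    and roots: "poly p a = 0" "poly (pderiv p) a = 0"
    and R: "cmod a = R" "R \<ge> 1"
  shows "R ^ 2 \<le> real n ^ 2 * H"
proof -
  obtain m where m: "n = Suc (Suc m)" using deg(3) by (metis add_2_eq_Suc le_Suc_ex)
  have *: "(\<Sum>i\<le>n. coeff p i * a ^ i) = 0" "(\<Sum>i\<le>n. of_nat i * coeff p i * a ^ i) = 0"
    using roots mult_poly_pderiv[of a p] by (simp_all add: poly_altdef deg(1))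
  \<comment> \<open>The weight \<open>i - (n - 1)\<close> vanishes at \<open>i = n - 1\<close> and
    is 1 at \<open>i = n\<close>: the unbounded coefficient drops out and the leading term
    survives.\<close>
  have "(\<Sum>i\<le>n. (of_nat i - of_nat (n - 1)) * coeff p i * a ^ i) =
      (\<Sum>i\<le>n. of_nat i * coeff p i * a ^ i) - of_nat (n - 1) * (\<Sum>i\<le>n. coeff p i * a ^ i)"
    by (simp only: sum_subtractf sum_distrib_left left_diff_distrib mult.assoc)
  also have "\<dots> = 0" using * by simp
  finally have "a ^ n = - (\<Sum>i\<le>m. (of_nat i - of_nat (n - 1)) * coeff p i * a ^ i)"
    using deg(1,2) by (simp add: m add_eq_0_iff)
  then have "R ^ n = cmod (\<Sum>i\<le>m. (of_nat i - of_nat (n - 1)) * coeff p i * a ^ i)"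
    using R by (metis norm_minus_cancel norm_power)
  also have "\<dots> \<le> (\<Sum>i\<le>m. cmod ((of_nat i - of_nat (n - 1)) * coeff p i * a ^ i))"
    by (rule norm_sum)
  also have "\<dots> \<le> (\<Sum>i\<le>m. real n * H * R ^ m)"
  proof (intro sum_mono)
    fix i assume "i \<in> {..m}"
    then have i: "i \<le> m" by simp
    have "(of_nat i - of_nat (n - 1) :: complex) = of_real (real i - real (n - 1))" by simp
    then have "cmod (of_nat i - of_nat (n - 1)) = \<bar>real i - real (n - 1)\<bar>"
      by (metis norm_of_real)
    also have "\<dots> \<le> real n" using i by (simp add: m)
    finally show "cmod ((of_nat i - of_nat (n - 1)) * coeff p i * a ^ i) \<le> real n * H * R ^ m"
      unfolding norm_mult norm_power R(1) using H i R(2)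
      by (intro mult_mono power_increasing) (auto simp: m)
  qed
  also have "\<dots> = (real (Suc m) * (real n * H)) * R ^ m" by simp
  finally have "R ^ 2 * R ^ m \<le> (real (Suc m) * (real n * H)) * R ^ m"
    by (simp add: m power2_eq_square mult_ac)
  then have "R ^ 2 \<le> real (Suc m) * (real n * H)" using R(2) by simp
  also have "\<dots> \<le> real n * (real n * H)" using H(2) by (intro mult_right_mono) (auto simp: m)
  finally show ?thesis by (simp add: power2_eq_square)
qed

section \<open>Counting the roots of maximal modulus\<close>

lemma length_filter_sorted_prefix:
  fixes f :: "'a \<Rightarrow> 'b :: linorder"
  assumes "sorted_wrt (\<lambda>x y. f x \<ge> f y) xs" "k \<le> length xs" "\<And>i. i < k \<Longrightarrow> f (xs ! i) = m"
    and "k = length xs \<or> f (xs ! k) < m"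
  shows "length (filter (\<lambda>x. f x = m) xs) = k"
proof -
  have "f x \<noteq> m" if "x \<in> set (drop k xs)" for x
  proof -
    obtain i where i: "i < length xs - k" "x = xs ! (k + i)"
      using \<open>x \<in> _\<close> by (auto simp: in_set_conv_nth)
    have "f (xs ! (k + i)) \<le> f (xs ! k)"
      using assms(1) i by (cases "i = 0") (auto simp: sorted_wrt_iff_nth_less)
    then show ?thesis using assms(4) i by auto
  qed
  moreover have "f x = m" if "x \<in> set (take k xs)" for x
    using that assms(2,3) by (auto simp: in_set_conv_nth)
  ultimately have "filter (\<lambda>x. f x = m) (take k xs @ drop k xs) = take k xs"
    unfolding filter_append by (simp cong: filter_cong add: filter_empty_conv)
  then show ?thesis using assms(2) by simp
qed

text \<open>Expresses \<open>k\<close> without reference to an ordering of the roots. Hence each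
  polynomial of positive degree has one and only one such \<open>k\<close>.\<close>

lemma has_exactly_max_modulus_roots_iff:
  fixes p :: "complex poly"
  assumes "degree p \<ge> 1"
  shows "has_exactly_max_modulus_roots p k \<longleftrightarrow>
    k = size {#x \<in># proots p. cmod x = Max (cmod ` set_mset (proots p))#}"
proof -
  define m where "m = Max (cmod ` set_mset (proots p))"
  have len: "length xs = degree p" if "mset xs = proots p" for xs
    using size_proots_complex[of p] by (simp flip: that)
  have hd: "cmod (xs ! 0) = m"
    if "mset xs = proots p" "sorted_wrt (\<lambda>x y. cmod x \<ge> cmod y) xs" for xs
  proof -
    have xs: "set_mset (proots p) = set xs" by (simp flip: that(1))
    show ?thesis unfolding m_def xs
    proof (rule Max_eqI[symmetric])
      fix y assume "y \<in> cmod ` set xs"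
      then obtain i where "i < length xs" "y = cmod (xs ! i)" by (auto simp: in_set_conv_nth)
      then show "y \<le> cmod (xs ! 0)"
        using that(2) by (cases "i = 0") (auto simp: sorted_wrt_iff_nth_less)
    qed (use len[OF that(1)] assms in auto)
  qed
  have size: "size {#x \<in># proots p. cmod x = m#} = length (filter (\<lambda>x. cmod x = m) xs)"
    if "mset xs = proots p" for xs
    by (simp flip: that mset_filter)
  show ?thesis unfolding m_def[symmetric]
  proof
    assume "has_exactly_max_modulus_roots p k"
    then obtain xs where xs: "1 \<le> k" "k \<le> degree p" "mset xs = proots p"
      "sorted_wrt (\<lambda>x y. cmod x \<ge> cmod y) xs" "\<forall>i<k. cmod (xs ! i) = cmod (xs ! 0)"
      "k = degree p \<or> cmod (xs ! (k - 1)) > cmod (xs ! k)"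
      unfolding has_exactly_max_modulus_roots_def by blast
    have "cmod (xs ! (k - 1)) = m" using xs hd[OF xs(3,4)] by simp
    then have "length (filter (\<lambda>x. cmod x = m) xs) = k"
      using xs hd[OF xs(3,4)] len[OF xs(3)] by (intro length_filter_sorted_prefix) auto
    then show "k = size {#x \<in># proots p. cmod x = m#}" using size[OF xs(3)] by simp
  next
    assume k: "k = size {#x \<in># proots p. cmod x = m#}"
    obtain ys where ys: "mset ys = proots p" using ex_mset by blast
    \<comment> \<open>Negating the key yields decreasing moduli; the longest prefix of modulus
      \<open>m\<close> then has the required length.\<close>
    define xs where "xs = sort_key (\<lambda>x. - cmod x) ys"
    have xs: "mset xs = proots p" by (simp add: xs_def ys)
    have srt: "sorted_wrt (\<lambda>x y. cmod x \<ge> cmod y) xs"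
      using sorted_sort_key[of "\<lambda>x. - cmod x" ys] unfolding xs_def sorted_map by simp
    define l where "l = length (takeWhile (\<lambda>x. cmod x = m) xs)"
    have l: "l \<le> length xs" unfolding l_def by (rule length_takeWhile_le)
    have pre: "cmod (xs ! i) = m" if "i < l" for i
    proof -
      have mem: "takeWhile (\<lambda>x. cmod x = m) xs ! i \<in> set (takeWhile (\<lambda>x. cmod x = m) xs)"
        using that unfolding l_def by (rule nth_mem)
      then show ?thesis
        using set_takeWhileD[OF mem] that by (simp add: takeWhile_nth l_def)
    qed
    have post: "l = length xs \<or> cmod (xs ! l) < m"
    proof (cases "l < length xs")
      case True
      then have "cmod (xs ! l) \<noteq> m" unfolding l_def by (rule nth_length_takeWhile)
      moreover have "cmod (xs ! l) \<le> cmod (xs ! 0)"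
        using True srt by (cases "l = 0") (auto simp: sorted_wrt_iff_nth_less)
      ultimately show ?thesis using hd[OF xs srt] by simp
    qed (use l in simp)
    have "length (filter (\<lambda>x. cmod x = m) xs) = l"
      using srt l pre post by (rule length_filter_sorted_prefix)
    then have "k = l" using k size[OF xs] by simp
    have "l \<noteq> 0"
    proof
      assume "l = 0"
      then show False using post hd[OF xs srt] len[OF xs] assms by simp
    qed
    then show "has_exactly_max_modulus_roots p k"
      unfolding has_exactly_max_modulus_roots_def \<open>k = l\<close>
      using xs srt l pre post hd[OF xs srt] len[OF xs] by (intro conjI exI[of _ xs]) auto
  qed
qed

section \<open>Boxes of integer polynomials and the sum over k\<close>

text \<open>The allowed set depends on the index, so that one product formula counts the full cube,
  the thin slab of the upper bound and the sub-box of the lower bound.\<close>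

definition monic_box :: "nat \<Rightarrow> (nat \<Rightarrow> int set) \<Rightarrow> int poly set" where
  "monic_box n B = {f. degree f = n \<and> lead_coeff f = 1 \<and> (\<forall>i<n. coeff f i \<in> B i)}"

lemma bij_betw_monic_box:
  "bij_betw (\<lambda>f. restrict (coeff f) {..<n}) (monic_box n B) (Pi\<^sub>E {..<n} B)"
proof (rule bij_betw_imageI)
  show "inj_on (\<lambda>f. restrict (coeff f) {..<n}) (monic_box n B)"
  proof (intro inj_onI poly_eqI)
    fix f g i
    assume fg: "f \<in> monic_box n B" "g \<in> monic_box n B"
      "restrict (coeff f) {..<n} = restrict (coeff g) {..<n}"
    consider "i < n" | "i = n" | "i > n" by linarith
    then show "coeff f i = coeff g i"
    proof cases
      case 1
      then show ?thesis using fun_cong[OF fg(3), of i] by simp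
    qed (use fg in \<open>auto simp: monic_box_def coeff_eq_0\<close>)
  qed
next
  show "(\<lambda>f. restrict (coeff f) {..<n}) ` monic_box n B = Pi\<^sub>E {..<n} B"
  proof (intro equalityI subsetI)
    fix g assume g: "g \<in> Pi\<^sub>E {..<n} B"
    define f where "f = Poly (map g [0..<n] @ [1])"
    have c: "coeff f i = (if i < n then g i else if i = n then 1 else 0)" for i
      by (auto simp: f_def nth_default_def nth_append)
    have "degree f = n"
      by (intro antisym degree_le le_degree) (auto simp: c)
    then have "f \<in> monic_box n B" using g by (auto simp: monic_box_def c)
    moreover have "restrict (coeff f) {..<n} = g"
      using g by (auto simp: c restrict_def PiE_def extensional_def fun_eq_iff)
    ultimately show "g \<in> (\<lambda>f. restrict (coeff f) {..<n}) ` monic_box n B" by blast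
  qed (auto simp: monic_box_def PiE_def extensional_def)
qed

lemma card_monic_box: "card (monic_box n B) = (\<Prod>i<n. card (B i))"
  using bij_betw_same_card[OF bij_betw_monic_box, of n B] by (simp add: card_PiE)

lemma card_monic_box_symmetric: "card (monic_box n (\<lambda>_. {- int H..int H})) = (2 * H + 1) ^ n"
  by (simp add: card_monic_box nat_add_distrib nat_mult_distrib)

lemma finite_monic_box: "(\<And>i. i < n \<Longrightarrow> finite (B i)) \<Longrightarrow> finite (monic_box n B)"
  unfolding bij_betw_finite[OF bij_betw_monic_box] by (intro finite_PiE) auto

text \<open>The leading coefficient 1 is at most \<open>H\<close> because \<open>H \<ge> 1\<close>,
  so the height restricts only the lower coefficients.\<close>

lemma height_of_int_le_iff:
  assumes "degree f = n" "lead_coeff f = 1" "H \<ge> 1"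
  shows "height (map_poly of_int f) \<le> real H \<longleftrightarrow> (\<forall>i<n. coeff f i \<in> {- int H..int H})"
proof -
  have "height (map_poly of_int f) \<le> real H \<longleftrightarrow> (\<forall>i\<le>n. \<bar>real_of_int (coeff f i)\<bar> \<le> real H)"
    unfolding height_def using assms(1) by (auto simp: degree_map_poly coeff_map_poly)
  also have "\<dots> \<longleftrightarrow> (\<forall>i\<le>n. \<bar>coeff f i\<bar> \<le> int H)"
    by (metis of_int_abs of_int_le_iff of_int_of_nat_eq)
  also have "\<dots> \<longleftrightarrow> (\<forall>i<n. \<bar>coeff f i\<bar> \<le> int H)"
    using assms by (auto simp: le_less)
  also have "\<dots> \<longleftrightarrow> (\<forall>i<n. coeff f i \<in> {- int H..int H})"
    by (simp add: abs_le_iff minus_le_iff conj_commute)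
  finally show ?thesis .
qed

lemma monic_polys_eq:
  assumes "H \<ge> 1"
  shows "monic_polys n k H =
    {f \<in> monic_box n (\<lambda>_. {- int H..int H}). has_exactly_max_modulus_roots (map_poly of_int f) k}"
  using height_of_int_le_iff[OF _ _ assms] unfolding monic_polys_def monic_box_def by blast

text \<open>Uniqueness of \<open>k\<close> makes the sets disjoint for different \<open>k\<close>,
  and its existence makes them cover the cube.\<close>

lemma sum_A_num:
  assumes "n \<ge> 1" "H \<ge> 1"
  shows "(\<Sum>k=1..n. A_num n k H) = (2 * H + 1) ^ n"
proof -
  let ?S = "monic_box n (\<lambda>_. {- int H..int H})"
  have d: "degree (map_poly of_int f :: complex poly) = n" if "f \<in> ?S" for f
    using that by (simp add: monic_box_def degree_map_poly)
  have "(\<Sum>k=1..n. A_num n k H) = card (\<Union>k\<in>{1..n}. monic_polys n k H)"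
    unfolding A_num_def
  proof (intro card_UN_disjoint[symmetric] ballI impI)
    fix i j :: nat assume "i \<noteq> j"
    then show "monic_polys n i H \<inter> monic_polys n j H = {}"
      using assms d by (auto simp: monic_polys_eq has_exactly_max_modulus_roots_iff)
  qed (auto intro: finite_monic_polys)
  also have "(\<Union>k\<in>{1..n}. monic_polys n k H) = ?S"
  proof (intro equalityI subsetI)
    fix f assume f: "f \<in> ?S"
    then obtain k where k: "has_exactly_max_modulus_roots (map_poly of_int f) k"
      using d assms has_exactly_max_modulus_roots_iff by metis
    then have "k \<in> {1..n}" using d[OF f] by (simp add: has_exactly_max_modulus_roots_def)
    with k f assms show "f \<in> (\<Union>k\<in>{1..n}. monic_polys n k H)" by (auto simp: monic_polys_eq)
  qed (use assms in \<open>auto simp: monic_polys_eq\<close>)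
  also have "card ?S = (2 * H + 1) ^ n" by (rule card_monic_box_symmetric)
  finally show ?thesis .
qed


text \<open>Turns the quantity to be estimated into the size of a complement, so that both bounds
  reduce to inclusions between boxes.\<close>

lemma card_Diff_monic_polys_1:
  assumes "H \<ge> 1"
  shows "real (card (monic_box n (\<lambda>_. {- int H..int H}) - monic_polys n 1 H)) =
    (2 * real H + 1) ^ n - real (A_num n 1 H)"
proof -
  let ?S = "monic_box n (\<lambda>_. {- int H..int H})"
  have sub: "monic_polys n 1 H \<subseteq> ?S" and fin: "finite ?S"
    using assms by (auto simp: monic_polys_eq intro: finite_monic_box)
  have "card ?S = (2 * H + 1) ^ n" by (rule card_monic_box_symmetric)
  moreover have "card (?S - monic_polys n 1 H) = card ?S - A_num n 1 H"
    unfolding A_num_def by (intro card_Diff_subset finite_monic_polys sub)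
  moreover have "A_num n 1 H \<le> card ?S"
    unfolding A_num_def by (intro card_mono sub fin)
  ultimately show ?thesis by (simp add: of_nat_diff add.commute)
qed

section \<open>Upper bound for the coefficient of X^(n-1)\<close>

lemma coeff_bound_of_two_max_modulus_roots:
  fixes p :: "complex poly"
  assumes deg: "degree p = n" "lead_coeff p = 1" "n \<ge> 2"
    and H: "\<And>i. i < n - 1 \<Longrightarrow> cmod (coeff p i) \<le> H" "H \<ge> 1"
    and k: "has_exactly_max_modulus_roots p k" "k \<ge> 2"
  shows "cmod (coeff p (n - 1)) \<le> real n ^ 2 * sqrt H"
proof -
  obtain xs where xs: "mset xs = proots p" "sorted_wrt (\<lambda>x y. cmod x \<ge> cmod y) xs"
      "\<forall>i<k. cmod (xs ! i) = cmod (xs ! 0)"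
    using k(1) unfolding has_exactly_max_modulus_roots_def by blast
  have len: "length xs = n"
    using size_proots_complex[of p] deg(1) by (simp flip: xs(1))
  obtain a b ys where ys: "xs = a # b # ys"
    using len deg(3) by (cases xs; cases "tl xs") auto
  have p0: "p \<noteq> 0" using deg(2) by auto
  have set_xs: "set xs = {x. poly p x = 0}"
    using p0 by (simp flip: set_mset_mset add: xs(1))
  define R where "R = cmod a"
  have R: "cmod a = R" "cmod b = R" "R \<ge> 0"
    using xs(3)[rule_format, of 1] k(2) by (simp_all add: R_def ys)
  have le_R: "cmod x \<le> R" if "poly p x = 0" for x
    using that xs(2) set_xs by (auto simp: ys R_def)
  \<comment> \<open>The root estimates need \<open>R \<ge> 1\<close>; a smaller \<open>R\<close> is
    harmless because \<open>n * sqrt H\<close> is at least 1.\<close>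
  have "R \<le> real n * sqrt H"
  proof (cases "R \<ge> 1")
    case True
    have "R ^ 2 \<le> real n ^ 2 * H"
    proof (cases "a = b")
      case False
      then show ?thesis
        using set_xs R True H deg
        by (intro two_distinct_roots_modulus_bound[of p n H a b]) (auto simp: ys)
    next
      case True
      \<comment> \<open>A repeated entry in the list of roots is a multiple root, hence also a root
        of the derivative.\<close>
      then have "order a p \<ge> 2"
        unfolding count_proots[OF p0, symmetric] xs(1)[symmetric] by (simp add: ys)
      moreover have "poly p a = 0" using set_xs by (auto simp: ys)
      ultimately have "order a (pderiv p) \<noteq> 0"
        using order_pderiv[OF p0, of a] by simp
      then have "poly (pderiv p) a = 0" by (simp add: order_root)
      with \<open>poly p a = 0\<close> show ?thesis
        using R \<open>R \<ge> 1\<close> H deg by (intro double_root_modulus_bound[of p n H a]) auto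
    qed
    then have "R ^ 2 \<le> (real n * sqrt H) ^ 2" using H(2) by (simp add: power_mult_distrib)
    then show ?thesis by (rule power2_le_imp_le) (use H(2) in simp)
  next
    case False
    have "1 * 1 \<le> real n * sqrt H" using H(2) deg(3) by (intro mult_mono) auto
    then show ?thesis using False by simp
  qed
  have "n choose (n - 1) = n"
    using deg(3) binomial_symmetric[of 1 n] by simp
  then have "cmod (coeff p (n - 1)) \<le> real n * R"
    using norm_coeff_le_of_roots[OF deg(2) le_R \<open>R \<ge> 0\<close>, of "n - 1"] deg by simp
  also have "\<dots> \<le> real n * (real n * sqrt H)"
    using \<open>R \<le> _\<close> by (intro mult_left_mono) auto
  finally show ?thesis by (simp add: power2_eq_square mult.assoc)
qed

section \<open>Polynomials without a unique root of maximal modulus\<close>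

text \<open>The top three terms are \<open>x ^ m\<close> times a quadratic that is at least
  \<open>H / 4\<close>, whereas for \<open>\<bar>x\<bar> > 5\<close> a geometric sum keeps the
  remaining terms below \<open>\<bar>x\<bar> ^ m * H / 4\<close>, so they cannot cancel.\<close>

lemma real_root_bound:
  fixes p :: "real poly"
  assumes deg: "degree p = m + 2" "lead_coeff p = 1"
    and H: "H > 0" "\<And>i. i < m \<Longrightarrow> \<bar>coeff p i\<bar> \<le> H"
    and c: "coeff p m \<ge> H / 2" "coeff p (m + 1) ^ 2 \<le> H / 2"
    and x: "poly p x = 0"
  shows "\<bar>x\<bar> \<le> 5"
proof (rule ccontr)
  assume "\<not> \<bar>x\<bar> \<le> 5"
  then have x5: "\<bar>x\<bar> > 5" by simp
  define c1 c2 where "c1 = coeff p (m + 1)" and "c2 = coeff p m"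
  define S where "S = (\<Sum>i<m. coeff p i * x ^ i)"
  have "x ^ m * (x ^ 2 + c1 * x + c2) + S = 0"
    using x deg poly_monic_split[of p "m + 2" x]
    by (simp add: S_def c1_def c2_def algebra_simps power2_eq_square)
  then have "\<bar>S\<bar> = \<bar>x\<bar> ^ m * \<bar>x ^ 2 + c1 * x + c2\<bar>"
    by (metis abs_minus_cancel abs_mult add_eq_0_iff power_abs)
  moreover have "\<bar>x ^ 2 + c1 * x + c2\<bar> \<ge> H / 4"
  proof -
    \<comment> \<open>This gives \<open>c1 * x \<ge> - (x ^ 2 + c1 ^ 2) / 2\<close>, so the
      quadratic is at least \<open>c2 - c1 ^ 2 / 2 \<ge> H / 2 - H / 4\<close>.\<close>
    have "0 \<le> x ^ 2 + c1 ^ 2 + 2 * (c1 * x)"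
      using zero_le_power2[of "x + c1"] by (simp add: power2_sum mult_ac)
    with zero_le_power2[of x] show ?thesis using c unfolding c1_def[symmetric] c2_def[symmetric] by linarith
  qed
  ultimately have lower: "\<bar>S\<bar> \<ge> \<bar>x\<bar> ^ m * (H / 4)"
    by (simp only: mult_left_mono zero_le_power abs_ge_zero)
  have "\<bar>S\<bar> \<le> (\<Sum>i<m. \<bar>coeff p i * x ^ i\<bar>)"
    unfolding S_def by (rule sum_abs)
  also have "\<dots> \<le> (\<Sum>i<m. H * \<bar>x\<bar> ^ i)"
    by (intro sum_mono) (auto simp: abs_mult power_abs intro!: mult_right_mono H)
  finally have "(\<bar>x\<bar> - 1) * \<bar>S\<bar> \<le> (\<bar>x\<bar> - 1) * (\<Sum>i<m. H * \<bar>x\<bar> ^ i)"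
    using x5 by (intro mult_left_mono) auto
  also have "\<dots> = H * (\<bar>x\<bar> ^ m - 1)"
    by (simp add: power_diff_1_eq flip: sum_distrib_left)
  also have "\<dots> < H * \<bar>x\<bar> ^ m" using H(1) by simp
  finally have "(\<bar>x\<bar> - 1) * \<bar>S\<bar> < H * \<bar>x\<bar> ^ m" .
  \<comment> \<open>The threshold 5 is chosen so that \<open>\<bar>x\<bar> - 1\<close> exceeds 4,
    the reciprocal of the factor in \<open>H / 4\<close>.\<close>
  moreover have "4 * \<bar>S\<bar> \<le> (\<bar>x\<bar> - 1) * \<bar>S\<bar>" using x5 by (intro mult_right_mono) auto
  ultimately show False using lower by (simp add: mult.commute)
qed

lemma of_real_poly_of_int:
  "poly (map_poly of_int f) (of_real x :: complex) = of_real (poly (map_poly of_int f) x)"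
  by (simp add: poly_altdef degree_map_poly coeff_map_poly)

text \<open>A unique root of maximal modulus of a real polynomial is fixed by complex conjugation.\<close>

lemma not_unique_max_modulus_root:
  fixes f :: "int poly"
  assumes deg: "degree f = m + 2" "lead_coeff f = 1"
    and H: "H > 50 * 2 ^ (m + 2)" "\<And>i. i < m \<Longrightarrow> \<bar>real_of_int (coeff f i)\<bar> \<le> H"
    and c: "real_of_int (coeff f m) \<ge> H / 2" "real_of_int (coeff f (m + 1)) ^ 2 \<le> H / 2"
  shows "\<not> has_exactly_max_modulus_roots (map_poly of_int f) 1"
proof
  define p :: "complex poly" where "p = map_poly of_int f"
  have degp: "degree p = m + 2" "lead_coeff p = 1"
    using deg by (auto simp: p_def degree_map_poly coeff_map_poly)
  then have p0: "p \<noteq> 0" by auto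
  have H0: "H > 0" by (rule less_trans[OF _ H(1)]) simp
  assume "has_exactly_max_modulus_roots (map_poly of_int f) 1"
  then obtain xs where xs: "mset xs = proots p" "sorted_wrt (\<lambda>x y. cmod x \<ge> cmod y) xs"
      "cmod (xs ! 0) > cmod (xs ! 1)"
    using degp unfolding has_exactly_max_modulus_roots_def p_def[symmetric] by auto
  have len: "length xs = m + 2"
    using size_proots_complex[of p] degp(1) by (simp flip: xs(1))
  obtain a b ys where ys: "xs = a # b # ys"
    using len by (cases xs; cases "tl xs") auto
  have set_xs: "set xs = {x. poly p x = 0}"
    using p0 by (simp flip: set_mset_mset add: xs(1))
  have "poly p a = 0" using set_xs by (auto simp: ys)
  moreover have "coeff p i \<in> \<real>" for i by (simp add: p_def coeff_map_poly)
  ultimately have "poly p (cnj a) = 0" using poly_cnj_real[of p a] by simp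
  then have "cnj a \<in> set xs" using set_xs by simp
  \<comment> \<open>The conjugate has the same modulus as \<open>a\<close>, but all entries after
    the head are strictly smaller.\<close>
  then have "cnj a = a" using xs(2,3) by (auto simp: ys)
  then obtain x where x: "a = of_real x" by (metis Reals_cnj_iff Reals_cases)
  have "\<bar>x\<bar> \<le> 5"
  proof (rule real_root_bound)
    show "poly (map_poly of_int f) x = 0"
      using \<open>poly p a = 0\<close> unfolding p_def x of_real_poly_of_int by simp
  qed (use deg H H0 c in \<open>auto simp: degree_map_poly coeff_map_poly\<close>)
  then have "cmod y \<le> 5" if "poly p y = 0" for y
  proof -
    have "y \<in> set xs" using that set_xs by simp
    then have "cmod y \<le> cmod a" using xs(2) by (auto simp: ys)
    then show ?thesis using \<open>\<bar>x\<bar> \<le> 5\<close> by (simp add: x)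
  qed
  \<comment> \<open>With all roots in the disc of radius 5, this coefficient is at most
    \<open>25 * 2 ^ (m + 2)\<close>; it is also at least \<open>H / 2\<close>, which explains the
    constant 50 in the hypothesis.\<close>
  then have "cmod (coeff p m) \<le> real (m + 2 choose m) * 25"
    using norm_coeff_le_of_roots[of p 5 m] degp by simp
  moreover have "real (m + 2 choose m) \<le> 2 ^ (m + 2)"
    using binomial_le_pow2[of "m + 2" m] by (metis of_nat_le_iff of_nat_numeral of_nat_power)
  moreover have "cmod (coeff p m) \<ge> H / 2"
    using c(1) by (simp add: p_def coeff_map_poly)
  ultimately show False using H(1) by linarith
qed

section \<open>Cardinality estimates for the complement\<close>

lemma powr_diff_half:
  assumes "n \<ge> 1" "x > 0"
  shows "x powr (real n - 1 / 2) = x ^ (n - 1) * sqrt x"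
proof -
  have "real n - 1 / 2 = real (n - 1) + 1 / 2" using assms(1) by (simp add: of_nat_diff)
  then show ?thesis using assms(2) by (simp only: powr_add powr_realpow powr_half_sqrt)
qed

text \<open>Outside \<open>monic_polys n 1 H\<close> some \<open>k \<ge> 2\<close> applies, so the
  coefficient of X^(n-1) takes O(sqrt H) values and each of the other \<open>n - 1\<close> takes
  \<open>2 * H + 1\<close>.\<close>

lemma card_Diff_monic_polys_1_le:
  assumes "n \<ge> 2" "H \<ge> 1"
  shows "real (card (monic_box n (\<lambda>_. {- int H..int H}) - monic_polys n 1 H))
    \<le> 3 ^ n * real n ^ 2 * real H powr (real n - 1 / 2)"
proof -
  define r where "r = \<lfloor>real n ^ 2 * sqrt (real H)\<rfloor>"
  define B where "B = (\<lambda>i. if i = n - 1 then {-r..r} else {- int H..int H})"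
  have "monic_box n (\<lambda>_. {- int H..int H}) - monic_polys n 1 H \<subseteq> monic_box n B"
  proof
    fix f assume f: "f \<in> monic_box n (\<lambda>_. {- int H..int H}) - monic_polys n 1 H"
    define p :: "complex poly" where "p = map_poly of_int f"
    have box: "degree f = n" "lead_coeff f = 1" "\<And>i. i < n \<Longrightarrow> coeff f i \<in> {- int H..int H}"
      using f by (auto simp: monic_box_def)
    then have degp: "degree p = n" "lead_coeff p = 1"
      by (auto simp: p_def degree_map_poly coeff_map_poly)
    obtain k where k: "has_exactly_max_modulus_roots p k"
      using degp(1) assms(1) has_exactly_max_modulus_roots_iff[of p] by auto
    moreover have "k \<noteq> 1" using f k assms(2) by (auto simp: monic_polys_eq p_def)
    ultimately have "k \<ge> 2" by (auto simp: has_exactly_max_modulus_roots_def)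
    have c: "cmod (coeff p i) = \<bar>real_of_int (coeff f i)\<bar>" for i
      by (simp add: p_def coeff_map_poly)
    have "cmod (coeff p (n - 1)) \<le> real n ^ 2 * sqrt (real H)"
    proof (rule coeff_bound_of_two_max_modulus_roots)
      show "cmod (coeff p i) \<le> real H" if "i < n - 1" for i using that box(3)[of i] by (simp add: c) linarith
      show "has_exactly_max_modulus_roots p k" by (rule k)
    qed (use degp assms \<open>k \<ge> 2\<close> in auto)
    then have "\<bar>coeff f (n - 1)\<bar> \<le> r" by (simp add: c r_def le_floor_iff)
    then show "f \<in> monic_box n B" using box by (auto simp: monic_box_def B_def abs_le_iff)
  qed
  then have "card (monic_box n (\<lambda>_. {- int H..int H}) - monic_polys n 1 H) \<le> card (monic_box n B)"
    by (intro card_mono finite_monic_box) (auto simp: B_def)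
  also have "\<dots> = nat (2 * r + 1) * (2 * H + 1) ^ (n - 1)"
  proof -
    obtain m where "n = Suc m" using assms(1) by (cases n) auto
    then show ?thesis
      by (simp add: card_monic_box B_def nat_add_distrib nat_mult_distrib algebra_simps)
  qed
  finally have "real (card (monic_box n (\<lambda>_. {- int H..int H}) - monic_polys n 1 H))
      \<le> real (nat (2 * r + 1) * (2 * H + 1) ^ (n - 1))"
    by (rule of_nat_mono)
  also have "\<dots> = real (nat (2 * r + 1)) * (2 * real H + 1) ^ (n - 1)"
    by (simp add: add.commute)
  \<comment> \<open>Both \<open>H\<close> and \<open>n ^ 2 * sqrt H\<close> are at least 1, so the
    summand 1 in each factor is absorbed by replacing 2 with 3.\<close>
  also have "\<dots> \<le> (3 * (real n ^ 2 * sqrt (real H))) * (3 * real H) ^ (n - 1)"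
  proof (intro mult_mono power_mono)
    have "1 * 1 \<le> real n ^ 2 * sqrt (real H)" using assms by (intro mult_mono) auto
    moreover from this have "r \<ge> 0" by (simp add: r_def)
    moreover have "real_of_int r \<le> real n ^ 2 * sqrt (real H)" by (simp add: r_def)
    ultimately show "real (nat (2 * r + 1)) \<le> 3 * (real n ^ 2 * sqrt (real H))" by simp
  qed (use assms in auto)
  also have "\<dots> = 3 ^ n * real n ^ 2 * real H powr (real n - 1 / 2)"
  proof -
    have "(3::real) ^ n = 3 * 3 ^ (n - 1)" using assms(1) by (cases n) auto
    then show ?thesis using assms by (simp add: powr_diff_half power_mult_distrib)
  qed
  finally show ?thesis .
qed

text \<open>An explicit sub-box avoids \<open>monic_polys n 1 H\<close>: the coefficient of X^(n-1)
  has order sqrt H choices, that of X^(n-2) fills the upper half of its range, and the others are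
  free.\<close>

lemma card_Diff_monic_polys_1_ge:
  assumes "n \<ge> 2" "H > 50 * 2 ^ n"
  shows "real H powr (real n - 1 / 2) / 4
    \<le> real (card (monic_box n (\<lambda>_. {- int H..int H}) - monic_polys n 1 H))"
proof -
  obtain m where n: "n = m + 2" using assms(1) by (metis add.commute le_Suc_ex)
  have H1: "H \<ge> 1" using assms(2) by simp
  define r where "r = \<lfloor>sqrt (real H / 2)\<rfloor>"
  have r: "r \<ge> 0" "real_of_int r \<le> sqrt (real H / 2)" "sqrt (real H / 2) \<le> real_of_int r + 1"
    by (simp_all add: r_def)
  have r2: "real_of_int r ^ 2 \<le> real H / 2"
    using power_mono[OF r(2), of 2] r(1) by simp
  have "real_of_int r \<le> real H"
  proof -
    have "real_of_int r ^ 2 \<le> real H ^ 2"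
      using r2 self_le_power[of "real H" 2] H1 by linarith
    then show ?thesis by (rule power2_le_imp_le) simp
  qed
  then have rH: "r \<le> int H" by linarith
  \<comment> \<open>\<open>H - H div 2\<close> is \<open>H / 2\<close> rounded up, which leaves
    \<open>H div 2 + 1 > H / 2\<close> values.\<close>
  define B where "B = (\<lambda>i. if i = m + 1 then {-r..r} else
    if i = m then {int (H - H div 2)..int H} else {- int H..int H})"
  have "monic_box n B \<subseteq> monic_box n (\<lambda>_. {- int H..int H}) - monic_polys n 1 H"
  proof
    fix f assume f: "f \<in> monic_box n B"
    then have box: "degree f = m + 2" "lead_coeff f = 1" "\<And>i. i < n \<Longrightarrow> coeff f i \<in> B i"
      by (auto simp: monic_box_def n)
    have sub: "B i \<subseteq> {- int H..int H}" for i using rH by (auto simp: B_def)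
    have "\<not> has_exactly_max_modulus_roots (map_poly of_int f) 1"
    proof (rule not_unique_max_modulus_root[of f m "real H"])
      show "real H > 50 * 2 ^ (m + 2)"
        using assms(2) unfolding n by (simp flip: of_nat_less_iff[where 'a = real])
      show "\<bar>real_of_int (coeff f i)\<bar> \<le> real H" if "i < m" for i
        using box(3)[of i] that by (auto simp: n B_def)
      have "coeff f m \<ge> int (H - H div 2)" using box(3)[of m] by (simp add: n B_def)
      then show "real_of_int (coeff f m) \<ge> real H / 2" by linarith
      have "\<bar>coeff f (m + 1)\<bar> \<le> r" using box(3)[of "m + 1"] by (simp add: n B_def abs_le_iff)
      then have "\<bar>real_of_int (coeff f (m + 1))\<bar> \<le> real_of_int r" by linarith
      then have "real_of_int (coeff f (m + 1)) ^ 2 \<le> real_of_int r ^ 2"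
        using power_mono[of "\<bar>real_of_int (coeff f (m + 1))\<bar>" "real_of_int r" 2] by simp
      then show "real_of_int (coeff f (m + 1)) ^ 2 \<le> real H / 2" using r2 by simp
    qed (use box in auto)
    moreover have "f \<in> monic_box n (\<lambda>_. {- int H..int H})"
      using f sub unfolding monic_box_def by blast
    ultimately show "f \<in> monic_box n (\<lambda>_. {- int H..int H}) - monic_polys n 1 H"
      using H1 by (simp add: monic_polys_eq)
  qed
  then have le: "card (monic_box n B) \<le> card (monic_box n (\<lambda>_. {- int H..int H}) - monic_polys n 1 H)"
    by (intro card_mono finite_Diff finite_monic_box) auto
  have card_B: "card (monic_box n B) = nat (2 * r + 1) * ((H div 2 + 1) * (2 * H + 1) ^ m)"
  proof -
    have "nat (int H + 1 - int (H - H div 2)) = H div 2 + 1" by linarith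
    then show ?thesis
      by (simp add: card_monic_box n B_def nat_add_distrib nat_mult_distrib algebra_simps)
  qed
  \<comment> \<open>The factor 1/4 is split into one half for each of the two restricted
    coefficients.\<close>
  have "real H powr (real n - 1 / 2) / 4 = (sqrt (real H) / 2) * ((real H / 2) * real H ^ m)"
    using assms(1) H1 by (subst powr_diff_half) (simp_all add: n)
  also have "\<dots> \<le> real (nat (2 * r + 1)) * (real (H div 2 + 1) * (2 * real H + 1) ^ m)"
  proof (intro mult_mono power_mono)
    have "sqrt (real H) / 2 = sqrt (real H / 4)" by (simp add: real_sqrt_divide)
    also have "\<dots> \<le> sqrt (real H / 2)" by simp
    also have "\<dots> \<le> real (nat (2 * r + 1))" using r by simp
    finally show "sqrt (real H) / 2 \<le> real (nat (2 * r + 1))" .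
  qed auto
  also have "\<dots> = real (card (monic_box n B))"
    unfolding card_B by (simp add: algebra_simps)
  also have "\<dots> \<le> real (card (monic_box n (\<lambda>_. {- int H..int H}) - monic_polys n 1 H))"
    using le by (rule of_nat_mono)
  finally show ?thesis .
qed

text \<open>The witness is X^n, whose only root 0 has multiplicity \<open>n \<ge> 2\<close>. It
  provides the lower bound for the finitely many small \<open>H\<close>.\<close>

lemma card_Diff_monic_polys_1_pos:
  assumes "n \<ge> 2" "H \<ge> 1"
  shows "card (monic_box n (\<lambda>_. {- int H..int H}) - monic_polys n 1 H) \<ge> 1"
proof -
  have "\<not> has_exactly_max_modulus_roots (monom 1 n) 1"
  proof
    assume "has_exactly_max_modulus_roots (monom 1 n) 1"
    then obtain xs where xs: "mset xs = proots (monom (1 :: complex) n)" "cmod (xs ! 0) > cmod (xs ! 1)"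
      using assms(1) by (auto simp: has_exactly_max_modulus_roots_def degree_monom_eq)
    have "length xs = n"
      using size_proots_complex[of "monom 1 n"] by (simp flip: xs(1) add: degree_monom_eq)
    then have "xs ! 0 \<in> set xs" using assms(1) by simp
    then have "xs ! 0 \<in># proots (monom 1 n)" by (simp flip: xs(1))
    then have "xs ! 0 = 0" by (simp add: poly_monom)
    then show False using xs(2) by simp
  qed
  then have "monom 1 n \<in> monic_box n (\<lambda>_. {- int H..int H}) - monic_polys n 1 H"
    using assms by (auto simp: monic_polys_eq monic_box_def degree_monom_eq map_poly_monom)
  moreover have "finite (monic_box n (\<lambda>_. {- int H..int H}) - monic_polys n 1 H)"
    by (intro finite_Diff finite_monic_box) auto
  ultimately show ?thesis by (metis One_nat_def Suc_leI card_gt_0_iff empty_iff)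
qed

theorem theorem3p1:
  fixes n :: nat
  assumes "n \<ge> 2"
  shows "\<exists>c\<^sub>1 c\<^sub>2 :: real. c\<^sub>1 > 0 \<and> c\<^sub>2 > 0 \<and>
    (\<forall>H::nat. H \<ge> 1 \<longrightarrow>
       c\<^sub>1 * real H powr (real n - 1/2) \<le> (2 * real H + 1) ^ n - real (A_num n 1 H) \<and>
       (2 * real H + 1) ^ n - real (A_num n 1 H) = (\<Sum>k = 2..n. real (A_num n k H)) \<and>
       (\<Sum>k = 2..n. real (A_num n k H)) \<le> c\<^sub>2 * real H powr (real n - 1/2))"
proof -
  define N :: real where "N = 50 * 2 ^ n"
  \<comment> \<open>The value 1/4 serves \<open>H > N\<close>. For \<open>H \<le> N\<close> the
    power of \<open>H\<close> is at most \<open>N ^ n\<close>, so \<open>1 / N ^ n\<close> brings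
    the left side down to 1, the guaranteed size of the complement.\<close>
  define c1 where "c1 = min (1 / 4) (1 / N ^ n)"
  have N: "N \<ge> 1" by (simp add: N_def) (rule order_trans[OF one_le_power[of 2 n]], auto)
  show ?thesis
  proof (intro exI conjI allI impI)
    show "c1 > 0" using N by (simp add: c1_def)
    show "3 ^ n * real n ^ 2 > 0" using assms by simp
    fix H :: nat assume H: "H \<ge> 1"
    note card = card_Diff_monic_polys_1[OF H, of n]
    have "(\<Sum>k=1..n. real (A_num n k H)) = real ((2 * H + 1) ^ n)"
      using sum_A_num[of n H] assms H by (metis of_nat_sum One_nat_def Suc_leD numeral_2_eq_2)
    moreover have "(\<Sum>k=1..n. real (A_num n k H)) =
        real (A_num n 1 H) + (\<Sum>k=2..n. real (A_num n k H))"
      using assms by (subst sum.atLeast_Suc_atMost) (auto simp: numeral_2_eq_2)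
    ultimately show eq: "(2 * real H + 1) ^ n - real (A_num n 1 H) = (\<Sum>k = 2..n. real (A_num n k H))"
      by (simp add: algebra_simps)
    show "(\<Sum>k = 2..n. real (A_num n k H)) \<le> 3 ^ n * real n ^ 2 * real H powr (real n - 1/2)"
      using card_Diff_monic_polys_1_le[OF assms H] unfolding eq[symmetric] card .
    show "c1 * real H powr (real n - 1/2) \<le> (2 * real H + 1) ^ n - real (A_num n 1 H)"
    proof (cases "H > 50 * 2 ^ n")
      case True
      have "c1 * real H powr (real n - 1/2) \<le> 1 / 4 * real H powr (real n - 1/2)"
        by (intro mult_right_mono) (auto simp: c1_def)
      also have "\<dots> \<le> (2 * real H + 1) ^ n - real (A_num n 1 H)"
        using card_Diff_monic_polys_1_ge[OF assms True] unfolding card by simp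
      finally show ?thesis .
    next
      case False
      then have HN: "real H \<le> N"
        by (simp add: N_def not_less flip: of_nat_le_iff[where 'a = real])
      have "real H powr (real n - 1/2) \<le> real H powr real n"
        using H by (intro powr_mono) auto
      also have "\<dots> = real H ^ n" using H by (simp add: powr_realpow)
      also have "\<dots> \<le> N ^ n" using HN by (intro power_mono) auto
      finally have "c1 * real H powr (real n - 1/2) \<le> 1 / N ^ n * N ^ n"
        using N by (intro mult_mono) (auto simp: c1_def)
      also have "\<dots> = 1" using N by simp
      also have "1 \<le> (2 * real H + 1) ^ n - real (A_num n 1 H)"
        using card_Diff_monic_polys_1_pos[OF assms H] unfolding card[symmetric] by simp
      finally show ?thesis .
    qed
  qed
qed

end
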